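(* For every bunch of formulae $\Gamma \in \mathcal{B}(\mathbb{F})$ and every formula $\varphi \in \mathbb{F}$: if $\Gamma \vdash \varphi$ (i.e. the sequent $\Gamma \triangleright \varphi$ is provable in the natural deduction system $\mathsf{NBI}$), then $\Gamma \Vdash \varphi$ (i.e. the sequent $\Gamma\triangleright\varphi$ is valid in the base-extension semantics).
   Context: **Syntax.** Fix a denumerable (countably infinite) set $\mathbb{A}$ of atoms. The set $\mathbb{F}$ of formulae of the logic of bunched implications (BI) is generated by $\varphi ::= p\in\mathbb{A} \mid \top \mid \bot \mid \top^{\ast} \mid \varphi\land\varphi \mid \varphi\lor\varphi \mid \varphi\to\varphi \mid \varphi\ast\varphi \mid \varphi\mathbin{-\!\ast}\varphi$. For a set $X$, the set $\mathcal{B}(X)$ of bunches over $X$ is generated by $\Gamma ::= x\in X \mid \varnothing_{+} \mid \varnothing_{\times} \mid (\Gamma ; \Gamma) \mid (\Gamma , \Gamma)$; here $;$ is the additive context-former with unit $\varnothing_+$, and $,$ is the multiplicative context-former with unit $\varnothing_\times$. $\Gamma(\Delta)$ denotes a bunch with a distinguished sub-bunch occurrence $\Delta$, and $\Gamma(\Delta')$ the result of replacing that occurrence by $\Delta'$. A contextual bunch over $X$ is a function $\mathcal{B}(X)\to\mathcal{B}(X)$ of the form $\Sigma\mapsto\Gamma(\Sigma)$ (equivalently, a bunch with exactly one hole), written $\Gamma(\cdot)$; the set of these is $\dot{\mathcal{B}}(X)$, and $(\cdot)$ denotes the identity. Coherent equivalence $\equiv$ is the least equivalence relation on $\mathcal{B}(X)$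 containing the commutative monoid equations for $;$ with unit $\varnothing_+$ and for $,$ with unit $\varnothing_\times$, and such that $\Delta\equiv\Delta'$ implies $\Gamma(\Delta)\equiv\Gamma(\Delta')$. **System $\mathsf{NBI}$.** A sequent is a pair $\Gamma\triangleright\varphi$ with $\Gamma\in\mathcal{B}(\mathbb{F})$, $\varphi\in\mathbb{F}$. $\Gamma\vdash\varphi$ means $\Gamma\triangleright\varphi$ is derivable by the rules (premisses $\Rightarrow$ conclusion): $\Rightarrow \varphi\triangleright\varphi$; $\Gamma'\triangleright\varphi \Rightarrow \Gamma\triangleright\varphi$ if $\Gamma\equiv\Gamma'$; $\Gamma(\Delta)\triangleright\varphi \Rightarrow \Gamma(\Delta;\Delta')\triangleright\varphi$; $\Gamma(\Delta;\Delta)\triangleright\varphi \Rightarrow \Gamma(\Delta)\triangleright\varphi$; $\Rightarrow \varnothing_\times\triangleright\top^\ast$; [$\Gamma(\varnothing_\times)\triangleright\chi$ and $\Delta\triangleright\top^\ast$] $\Rightarrow \Gamma(\Delta)\triangleright\chi$; $(\Gamma,\varphi)\triangleright\psi \Rightarrow \Gamma\triangleright\varphi\mathbin{-\!\ast}\psi$; [$\Gamma\triangleright\varphi\mathbin{-\!\ast}\psi$ and $\Delta\triangleright\varphi$] $\Rightarrow (\Gamma,\Delta)\triangleright\psi$; [$\Gamma\triangleright\varphi$ and $\Delta\triangleright\psi$] $\Rightarrow (\Gamma,\Delta)\triangleright\varphi\ast\psi$; [$\Gamma(\varphi,\psi)\triangleright\chi$ and $\Delta\triangleright\varphi\ast\psi$]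 $\Rightarrow \Gamma(\Delta)\triangleright\chi$; $\Rightarrow \varnothing_+\triangleright\top$; [$\Gamma(\varnothing_+)\triangleright\chi$ and $\Delta\triangleright\top$] $\Rightarrow \Gamma(\Delta)\triangleright\chi$; $(\Gamma;\varphi)\triangleright\psi \Rightarrow \Gamma\triangleright\varphi\to\psi$; [$\Gamma\triangleright\varphi\to\psi$ and $\Delta\triangleright\varphi$] $\Rightarrow (\Gamma;\Delta)\triangleright\psi$; [$\Gamma\triangleright\varphi$ and $\Delta\triangleright\psi$] $\Rightarrow (\Gamma;\Delta)\triangleright\varphi\land\psi$; [$\Gamma(\varphi;\psi)\triangleright\chi$ and $\Delta\triangleright\varphi\land\psi$] $\Rightarrow \Gamma(\Delta)\triangleright\chi$; $\Gamma\triangleright\varphi_i \Rightarrow \Gamma\triangleright\varphi_1\lor\varphi_2$ ($i\in\{1,2\}$); [$\Gamma(\varphi)\triangleright\chi$ and $\Gamma(\psi)\triangleright\chi$ and $\Delta\triangleright\varphi\lor\psi$] $\Rightarrow \Gamma(\Delta)\triangleright\chi$; $\Gamma\triangleright\bot \Rightarrow \Gamma\triangleright\varphi$. **Bases.** An atomic rule is a pair consisting of a finite (possibly empty) set of premisses $P_1\triangleright p_1,\dots,P_n\triangleright p_n$ and a conclusion $P\triangleright p$, with $P_i,P\in\mathcal{B}(\mathbb{A})$, $p_i,p\in\mathbb{A}$; rules are not closed under substitution. A base is a set of atomic rules; $\mathscr{C}$ extends $\mathscr{B}$ when $\mathscr{C}\supseteq\mathscr{B}$. Derivability $\vdash_{\mathscr{B}}$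 is the smallest relation between $\mathcal{B}(\mathbb{A})$ and $\mathbb{A}$ such that: $p\vdash_{\mathscr{B}}p$; if a rule of $\mathscr{B}$ has premisses $P_i\triangleright p_i$ ($i=1,\dots,n$, $n\ge 0$) and conclusion $P\triangleright p$, and $P_i\vdash_{\mathscr{B}}p_i$ for all $i$, then $P\vdash_{\mathscr{B}}p$; if $P(Q)\vdash_{\mathscr{B}}p$ then $P(Q;Q')\vdash_{\mathscr{B}}p$ for any $Q'\in\mathcal{B}(\mathbb{A})$; if $P(Q;Q)\vdash_{\mathscr{B}}p$ then $P(Q)\vdash_{\mathscr{B}}p$; if $P(Q)\vdash_{\mathscr{B}}p$ and $Q\equiv Q'$ then $P(Q')\vdash_{\mathscr{B}}p$; if $T\vdash_{\mathscr{B}}q$ and $S(q)\vdash_{\mathscr{B}}p$ then $S(T)\vdash_{\mathscr{B}}p$. **Bunch-extension.** $\succeq$ is the least transitive relation on bunches such that $\Gamma\succeq\Gamma'$ whenever $\Gamma$ is coherently equivalent to the result of replacing some sub-bunch occurrence $\Delta$ of $\Gamma'$ by $(\Delta;\Delta')$, for some bunch $\Delta'$. $\Gamma'\preceq\Gamma$ means $\Gamma\succeq\Gamma'$. **Support.** For a base $\mathscr{B}$, $S\in\mathcal{B}(\mathbb{A})$ and $R(\cdot)\in\dot{\mathcal{B}}(\mathbb{A})$, support of formulae, of bunches of formulae, and of sequents is defined inductively ($\mathscr{X}$ ranges over bases, $U(\cdot)$ over $\dot{\mathcal{B}}(\mathbb{A})$, $U,Q_1,Q_2$ over $\mathcal{B}(\mathbb{A})$,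 $p$ over $\mathbb{A}$): - $\Vdash^{S}_{\mathscr{B}}p$ iff $S\vdash_{\mathscr{B}}p$; - $\Vdash^{S}_{\mathscr{B}}\varphi\land\psi$ iff for all $\mathscr{X}\supseteq\mathscr{B}$, $U(\cdot)$, $p$: if $(\varphi;\psi)\Vdash^{U(\cdot)}_{\mathscr{X}}p$ then $\Vdash^{U(S)}_{\mathscr{X}}p$; - $\Vdash^{S}_{\mathscr{B}}\varphi\ast\psi$ iff for all $\mathscr{X}\supseteq\mathscr{B}$, $U(\cdot)$, $p$: if $(\varphi,\psi)\Vdash^{U(\cdot)}_{\mathscr{X}}p$ then $\Vdash^{U(S)}_{\mathscr{X}}p$; - $\Vdash^{S}_{\mathscr{B}}\varphi\lor\psi$ iff for all $\mathscr{X}\supseteq\mathscr{B}$, $U(\cdot)$, $p$: if $\varphi\Vdash^{U(\cdot)}_{\mathscr{X}}p$ and $\psi\Vdash^{U(\cdot)}_{\mathscr{X}}p$ then $\Vdash^{U(S)}_{\mathscr{X}}p$; - $\Vdash^{S}_{\mathscr{B}}\varphi\to\psi$ iff $\varphi\Vdash^{S;(\cdot)}_{\mathscr{B}}\psi$; - $\Vdash^{S}_{\mathscr{B}}\varphi\mathbin{-\!\ast}\psi$ iff $\varphi\Vdash^{S,(\cdot)}_{\mathscr{B}}\psi$; - $\Vdash^{S}_{\mathscr{B}}\bot$ iff for all $U(\cdot)$ and $p$: $\Vdash^{U(S)}_{\mathscr{B}}p$; - $\Vdash^{S}_{\mathscr{B}}\top$ iff for all $\mathscr{X}\supseteq\mathscr{B}$,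 $U(\cdot)$, $p$: if $\Vdash^{U(\varnothing_+)}_{\mathscr{X}}p$ then $\Vdash^{U(S)}_{\mathscr{X}}p$; - $\Vdash^{S}_{\mathscr{B}}\top^\ast$ iff for all $\mathscr{X}\supseteq\mathscr{B}$, $U(\cdot)$, $p$: if $\Vdash^{U(\varnothing_\times)}_{\mathscr{X}}p$ then $\Vdash^{U(S)}_{\mathscr{X}}p$; - $\Gamma\Vdash^{R(\cdot)}_{\mathscr{B}}\psi$ iff for all $\mathscr{X}\supseteq\mathscr{B}$ and $U$: if $\Vdash^{U}_{\mathscr{X}}\Gamma$ then $\Vdash^{R(U)}_{\mathscr{X}}\psi$; - $\Vdash^{S}_{\mathscr{B}}\varnothing_\times$ iff $S\succeq\varnothing_\times$; - $\Vdash^{S}_{\mathscr{B}}\varnothing_+$ always; - $\Vdash^{S}_{\mathscr{B}}(\Gamma,\Delta)$ iff there are $Q_1,Q_2$ with $S\succeq(Q_1,Q_2)$, $\Vdash^{Q_1}_{\mathscr{B}}\Gamma$ and $\Vdash^{Q_2}_{\mathscr{B}}\Delta$; - $\Vdash^{S}_{\mathscr{B}}(\Gamma;\Delta)$ iff there are $Q_1,Q_2$ with $S\succeq Q_1$, $S\succeq Q_2$, $\Vdash^{Q_1}_{\mathscr{B}}\Gamma$ and $\Vdash^{Q_2}_{\mathscr{B}}\Delta$. **Validity.** $\Gamma\Vdash\varphi$ iff $\Gamma\Vdash^{(\cdot)}_{\mathscr{B}}\varphi$ for every base $\mathscr{B}$. *)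

theory Defs
  imports Main "HOL-Library.Countable" "HOL-Library.Infinite_Typeclass" "HOL-Library.FSet"
begin

section \<open>Syntax\<close>

datatype 'a formula =
    Atom 'a
  | Top  ("\<^bold>\<top>")
  | Bot  ("\<^bold>\<bottom>")
  | MTop ("\<^bold>\<top>\<^sup>*")
  | And  "'a formula" "'a formula" (infixr "\<^bold>\<and>" 75)
  | Or   "'a formula" "'a formula" (infixr "\<^bold>\<or>" 74)
  | Imp  "'a formula" "'a formula" (infixr "\<^bold>\<rightarrow>" 73)
  | Star "'a formula" "'a formula" (infixr "\<^bold>*" 75)
  | Wand "'a formula" "'a formula" (infixr "\<^bold>-\<^bold>*" 73)

datatype 'x bunch =
    Elem 'x
  | AUnit ("\<emptyset>\<^sub>+")
  | MUnit ("\<emptyset>\<^sub>\<times>")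
  | Semi  "'x bunch" "'x bunch" (infixr "\<^bold>;" 71)
  | Comma "'x bunch" "'x bunch" (infixr "\<^bold>," 71)

text \<open>
  A contextual bunch is a bunch with exactly one hole. A bunch \<open>\<Gamma>(\<Delta>)\<close> with a distinguished
  sub-bunch occurrence is \<open>C\<langle>\<Delta>\<rangle>\<close> for a contextual bunch \<open>C\<close>.
\<close>

datatype 'x bctx =
    Hole
  | SemiL  "'x bctx" "'x bunch"
  | SemiR  "'x bunch" "'x bctx"
  | CommaL "'x bctx" "'x bunch"
  | CommaR "'x bunch" "'x bctx"

primrec fill :: "'x bctx \<Rightarrow> 'x bunch \<Rightarrow> 'x bunch" ("_\<langle>_\<rangle>" [1000, 0] 1000) where
  "Hole\<langle>\<Delta>\<rangle> = \<Delta>"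
| "(SemiL C \<Gamma>)\<langle>\<Delta>\<rangle> = (C\<langle>\<Delta>\<rangle> \<^bold>; \<Gamma>)"
| "(SemiR \<Gamma> C)\<langle>\<Delta>\<rangle> = (\<Gamma> \<^bold>; C\<langle>\<Delta>\<rangle>)"
| "(CommaL C \<Gamma>)\<langle>\<Delta>\<rangle> = (C\<langle>\<Delta>\<rangle> \<^bold>, \<Gamma>)"
| "(CommaR \<Gamma> C)\<langle>\<Delta>\<rangle> = (\<Gamma> \<^bold>, C\<langle>\<Delta>\<rangle>)"

inductive coh :: "'x bunch \<Rightarrow> 'x bunch \<Rightarrow> bool" (infix "\<cong>" 50) where
  refl: "\<Gamma> \<cong> \<Gamma>"
| sym: "\<Gamma> \<cong> \<Delta> \<Longrightarrow> \<Delta> \<cong> \<Gamma>"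
| trans: "\<Gamma> \<cong> \<Delta> \<Longrightarrow> \<Delta> \<cong> \<Sigma> \<Longrightarrow> \<Gamma> \<cong> \<Sigma>"
| semi_comm: "(\<Gamma> \<^bold>; \<Delta>) \<cong> (\<Delta> \<^bold>; \<Gamma>)"
| semi_assoc: "((\<Gamma> \<^bold>; \<Delta>) \<^bold>; \<Sigma>) \<cong> (\<Gamma> \<^bold>; (\<Delta> \<^bold>; \<Sigma>))"
| semi_unit: "(\<Gamma> \<^bold>; \<emptyset>\<^sub>+) \<cong> \<Gamma>"
| comma_comm: "(\<Gamma> \<^bold>, \<Delta>) \<cong> (\<Delta> \<^bold>, \<Gamma>)"
| comma_assoc: "((\<Gamma> \<^bold>, \<Delta>) \<^bold>, \<Sigma>) \<cong> (\<Gamma> \<^bold>, (\<Delta> \<^bold>, \<Sigma>))"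
| comma_unit: "(\<Gamma> \<^bold>, \<emptyset>\<^sub>\<times>) \<cong> \<Gamma>"
| cong: "\<Delta> \<cong> \<Delta>' \<Longrightarrow> C\<langle>\<Delta>\<rangle> \<cong> C\<langle>\<Delta>'\<rangle>"

inductive bext :: "'x bunch \<Rightarrow> 'x bunch \<Rightarrow> bool" (infix "\<succeq>" 50) where
  step: "\<Gamma> \<cong> C\<langle>\<Delta> \<^bold>; \<Delta>'\<rangle> \<Longrightarrow> \<Gamma> \<succeq> C\<langle>\<Delta>\<rangle>"
| trans: "\<Gamma> \<succeq> \<Delta> \<Longrightarrow> \<Delta> \<succeq> \<Sigma> \<Longrightarrow> \<Gamma> \<succeq> \<Sigma>"


section \<open>The natural deduction system NBI\<close>

inductive nbi :: "'a formula bunch \<Rightarrow> 'a formula \<Rightarrow> bool" (infix "\<turnstile>" 50) where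
  ax: "Elem \<phi> \<turnstile> \<phi>"
| exch: "\<Gamma>' \<turnstile> \<phi> \<Longrightarrow> \<Gamma> \<cong> \<Gamma>' \<Longrightarrow> \<Gamma> \<turnstile> \<phi>"
| weak: "C\<langle>\<Delta>\<rangle> \<turnstile> \<phi> \<Longrightarrow> C\<langle>\<Delta> \<^bold>; \<Delta>'\<rangle> \<turnstile> \<phi>"
| contr: "C\<langle>\<Delta> \<^bold>; \<Delta>\<rangle> \<turnstile> \<phi> \<Longrightarrow> C\<langle>\<Delta>\<rangle> \<turnstile> \<phi>"
| mtopI: "\<emptyset>\<^sub>\<times> \<turnstile> \<^bold>\<top>\<^sup>*"
| mtopE: "C\<langle>\<emptyset>\<^sub>\<times>\<rangle> \<turnstile> \<chi> \<Longrightarrow> \<Delta> \<turnstile> \<^bold>\<top>\<^sup>* \<Longrightarrow> C\<langle>\<Delta>\<rangle> \<turnstile> \<chi>"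
| wandI: "(\<Gamma> \<^bold>, Elem \<phi>) \<turnstile> \<psi> \<Longrightarrow> \<Gamma> \<turnstile> \<phi> \<^bold>-\<^bold>* \<psi>"
| wandE: "\<Gamma> \<turnstile> \<phi> \<^bold>-\<^bold>* \<psi> \<Longrightarrow> \<Delta> \<turnstile> \<phi> \<Longrightarrow> (\<Gamma> \<^bold>, \<Delta>) \<turnstile> \<psi>"
| starI: "\<Gamma> \<turnstile> \<phi> \<Longrightarrow> \<Delta> \<turnstile> \<psi> \<Longrightarrow> (\<Gamma> \<^bold>, \<Delta>) \<turnstile> \<phi> \<^bold>* \<psi>"
| starE: "C\<langle>Elem \<phi> \<^bold>, Elem \<psi>\<rangle> \<turnstile> \<chi> \<Longrightarrow> \<Delta> \<turnstile> \<phi> \<^bold>* \<psi> \<Longrightarrow> C\<langle>\<Delta>\<rangle> \<turnstile> \<chi>"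
| topI: "\<emptyset>\<^sub>+ \<turnstile> \<^bold>\<top>"
| topE: "C\<langle>\<emptyset>\<^sub>+\<rangle> \<turnstile> \<chi> \<Longrightarrow> \<Delta> \<turnstile> \<^bold>\<top> \<Longrightarrow> C\<langle>\<Delta>\<rangle> \<turnstile> \<chi>"
| impI: "(\<Gamma> \<^bold>; Elem \<phi>) \<turnstile> \<psi> \<Longrightarrow> \<Gamma> \<turnstile> \<phi> \<^bold>\<rightarrow> \<psi>"
| impE: "\<Gamma> \<turnstile> \<phi> \<^bold>\<rightarrow> \<psi> \<Longrightarrow> \<Delta> \<turnstile> \<phi> \<Longrightarrow> (\<Gamma> \<^bold>; \<Delta>) \<turnstile> \<psi>"
| andI: "\<Gamma> \<turnstile> \<phi> \<Longrightarrow> \<Delta> \<turnstile> \<psi> \<Longrightarrow> (\<Gamma> \<^bold>; \<Delta>) \<turnstile> \<phi> \<^bold>\<and> \<psi>"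
| andE: "C\<langle>Elem \<phi> \<^bold>; Elem \<psi>\<rangle> \<turnstile> \<chi> \<Longrightarrow> \<Delta> \<turnstile> \<phi> \<^bold>\<and> \<psi> \<Longrightarrow> C\<langle>\<Delta>\<rangle> \<turnstile> \<chi>"
| orI1: "\<Gamma> \<turnstile> \<phi> \<Longrightarrow> \<Gamma> \<turnstile> \<phi> \<^bold>\<or> \<psi>"
| orI2: "\<Gamma> \<turnstile> \<psi> \<Longrightarrow> \<Gamma> \<turnstile> \<phi> \<^bold>\<or> \<psi>"
| orE: "C\<langle>Elem \<phi>\<rangle> \<turnstile> \<chi> \<Longrightarrow> C\<langle>Elem \<psi>\<rangle> \<turnstile> \<chi> \<Longrightarrow> \<Delta> \<turnstile> \<phi> \<^bold>\<or> \<psi> \<Longrightarrow> C\<langle>\<Delta>\<rangle> \<turnstile> \<chi>"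
| botE: "\<Gamma> \<turnstile> \<^bold>\<bottom> \<Longrightarrow> \<Gamma> \<turnstile> \<phi>"


section \<open>Bases and derivability in a base\<close>

type_synonym 'a asequent = "'a bunch \<times> 'a"
type_synonym 'a arule = "'a asequent fset \<times> 'a asequent"
type_synonym 'a base = "'a arule set"

inductive deriv :: "'a base \<Rightarrow> 'a bunch \<Rightarrow> 'a \<Rightarrow> bool" for \<B> :: "'a base" where
  taut: "deriv \<B> (Elem p) p"
| rule: "(Ps, (P, p)) \<in> \<B> \<Longrightarrow> (\<forall>Q q. (Q, q) |\<in>| Ps \<longrightarrow> deriv \<B> Q q) \<Longrightarrow> deriv \<B> P p"
| weak: "deriv \<B> C\<langle>Q\<rangle> p \<Longrightarrow> deriv \<B> C\<langle>Q \<^bold>; Q'\<rangle> p"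
| contr: "deriv \<B> C\<langle>Q \<^bold>; Q\<rangle> p \<Longrightarrow> deriv \<B> C\<langle>Q\<rangle> p"
| exch: "deriv \<B> C\<langle>Q\<rangle> p \<Longrightarrow> Q \<cong> Q' \<Longrightarrow> deriv \<B> C\<langle>Q'\<rangle> p"
| cut: "deriv \<B> T q \<Longrightarrow> deriv \<B> C\<langle>Elem q\<rangle> p \<Longrightarrow> deriv \<B> C\<langle>T\<rangle> p"


section \<open>Base-extension semantics\<close>

text \<open>Weights used only for the termination of the mutual definition of support.\<close>

primrec fweight :: "'a formula \<Rightarrow> nat" where
  "fweight (Atom p) = 0"
| "fweight \<^bold>\<top> = 1"
| "fweight \<^bold>\<bottom> = 1"
| "fweight \<^bold>\<top>\<^sup>* = 1"
| "fweight (\<phi> \<^bold>\<and> \<psi>) = fweight \<phi> + fweight \<psi> + 5"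
| "fweight (\<phi> \<^bold>\<or> \<psi>) = fweight \<phi> + fweight \<psi> + 5"
| "fweight (\<phi> \<^bold>\<rightarrow> \<psi>) = fweight \<phi> + fweight \<psi> + 5"
| "fweight (\<phi> \<^bold>* \<psi>) = fweight \<phi> + fweight \<psi> + 5"
| "fweight (\<phi> \<^bold>-\<^bold>* \<psi>) = fweight \<phi> + fweight \<psi> + 5"

primrec bweight :: "'a formula bunch \<Rightarrow> nat" where
  "bweight (Elem \<phi>) = fweight \<phi> + 1"
| "bweight \<emptyset>\<^sub>+ = 0"
| "bweight \<emptyset>\<^sub>\<times> = 0"
| "bweight (\<Gamma> \<^bold>; \<Delta>) = bweight \<Gamma> + bweight \<Delta> + 1"
| "bweight (\<Gamma> \<^bold>, \<Delta>) = bweight \<Gamma> + bweight \<Delta> + 1"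

text \<open>
  With \<open>S\<close> a bunch of atoms and \<open>R\<close> a contextual bunch of atoms, \<open>fsupp \<B> S \<phi>\<close>
  and \<open>bsupp \<B> S \<Gamma>\<close> are support of a formula and of a bunch of formulae at \<open>S\<close> in
  \<open>\<B>\<close>, and \<open>ssupp \<B> R \<Gamma> \<psi>\<close> is support of the sequent with antecedent \<open>\<Gamma>\<close> and
  succedent \<open>\<psi>\<close> at \<open>R\<close> in \<open>\<B>\<close>. The contextual bunches \<open>S ; (\<cdot>)\<close> and \<open>S , (\<cdot>)\<close> are
  \<open>SemiR S Hole\<close> and \<open>CommaR S Hole\<close>.
\<close>

function
  fsupp :: "'a base \<Rightarrow> 'a bunch \<Rightarrow> 'a formula \<Rightarrow> bool" and
  bsupp :: "'a base \<Rightarrow> 'a bunch \<Rightarrow> 'a formula bunch \<Rightarrow> bool" and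
  ssupp :: "'a base \<Rightarrow> 'a bctx \<Rightarrow> 'a formula bunch \<Rightarrow> 'a formula \<Rightarrow> bool"
where
  "fsupp \<B> S (Atom p) \<longleftrightarrow> deriv \<B> S p"
| "fsupp \<B> S (\<phi> \<^bold>\<and> \<psi>) \<longleftrightarrow>
     (\<forall>\<X> U p. \<B> \<subseteq> \<X> \<longrightarrow> ssupp \<X> U (Elem \<phi> \<^bold>; Elem \<psi>) (Atom p) \<longrightarrow> fsupp \<X> U\<langle>S\<rangle> (Atom p))"
| "fsupp \<B> S (\<phi> \<^bold>* \<psi>) \<longleftrightarrow>
     (\<forall>\<X> U p. \<B> \<subseteq> \<X> \<longrightarrow> ssupp \<X> U (Elem \<phi> \<^bold>, Elem \<psi>) (Atom p) \<longrightarrow> fsupp \<X> U\<langle>S\<rangle> (Atom p))"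
| "fsupp \<B> S (\<phi> \<^bold>\<or> \<psi>) \<longleftrightarrow>
     (\<forall>\<X> U p. \<B> \<subseteq> \<X> \<longrightarrow> ssupp \<X> U (Elem \<phi>) (Atom p) \<longrightarrow> ssupp \<X> U (Elem \<psi>) (Atom p) \<longrightarrow>
        fsupp \<X> U\<langle>S\<rangle> (Atom p))"
| "fsupp \<B> S (\<phi> \<^bold>\<rightarrow> \<psi>) \<longleftrightarrow> ssupp \<B> (SemiR S Hole) (Elem \<phi>) \<psi>"
| "fsupp \<B> S (\<phi> \<^bold>-\<^bold>* \<psi>) \<longleftrightarrow> ssupp \<B> (CommaR S Hole) (Elem \<phi>) \<psi>"
| "fsupp \<B> S \<^bold>\<bottom> \<longleftrightarrow> (\<forall>U p. fsupp \<B> U\<langle>S\<rangle> (Atom p))"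
| "fsupp \<B> S \<^bold>\<top> \<longleftrightarrow>
     (\<forall>\<X> U p. \<B> \<subseteq> \<X> \<longrightarrow> fsupp \<X> U\<langle>\<emptyset>\<^sub>+\<rangle> (Atom p) \<longrightarrow> fsupp \<X> U\<langle>S\<rangle> (Atom p))"
| "fsupp \<B> S \<^bold>\<top>\<^sup>* \<longleftrightarrow>
     (\<forall>\<X> U p. \<B> \<subseteq> \<X> \<longrightarrow> fsupp \<X> U\<langle>\<emptyset>\<^sub>\<times>\<rangle> (Atom p) \<longrightarrow> fsupp \<X> U\<langle>S\<rangle> (Atom p))"
| "ssupp \<B> R \<Gamma> \<psi> \<longleftrightarrow> (\<forall>\<X> U. \<B> \<subseteq> \<X> \<longrightarrow> bsupp \<X> U \<Gamma> \<longrightarrow> fsupp \<X> R\<langle>U\<rangle> \<psi>)"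
| "bsupp \<B> S (Elem \<phi>) \<longleftrightarrow> fsupp \<B> S \<phi>"
| "bsupp \<B> S \<emptyset>\<^sub>\<times> \<longleftrightarrow> S \<succeq> \<emptyset>\<^sub>\<times>"
| "bsupp \<B> S \<emptyset>\<^sub>+ \<longleftrightarrow> True"
| "bsupp \<B> S (\<Gamma> \<^bold>, \<Delta>) \<longleftrightarrow>
     (\<exists>Q\<^sub>1 Q\<^sub>2. S \<succeq> (Q\<^sub>1 \<^bold>, Q\<^sub>2) \<and> bsupp \<B> Q\<^sub>1 \<Gamma> \<and> bsupp \<B> Q\<^sub>2 \<Delta>)"
| "bsupp \<B> S (\<Gamma> \<^bold>; \<Delta>) \<longleftrightarrow>
     (\<exists>Q\<^sub>1 Q\<^sub>2. S \<succeq> Q\<^sub>1 \<and> S \<succeq> Q\<^sub>2 \<and> bsupp \<B> Q\<^sub>1 \<Gamma> \<and> bsupp \<B> Q\<^sub>2 \<Delta>)"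
  by pat_completeness auto
termination
  by (relation "measure (case_sum (\<lambda>(\<B>, S, \<phi>). fweight \<phi>)
        (case_sum (\<lambda>(\<B>, S, \<Gamma>). bweight \<Gamma>) (\<lambda>(\<B>, R, \<Gamma>, \<psi>). bweight \<Gamma> + fweight \<psi> + 1)))")
     auto

definition valid :: "'a formula bunch \<Rightarrow> 'a formula \<Rightarrow> bool" (infix "\<tturnstile>" 50) where
  "\<Gamma> \<tturnstile> \<phi> \<longleftrightarrow> (\<forall>\<B>. ssupp \<B> Hole \<Gamma> \<phi>)"

end

theory Submission imports Defs begin

text \<open>
  The clauses for the positive connectives only test support against atoms. The key step
  (\<open>fsupp_elim\<close>) lifts such a test to arbitrary formulae, by induction on the formula and for an
  arbitrary family of resources, so that it covers all elimination rules at once.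

  Bunch-extension lacks contraction, so a resource supporting \<open>C\<langle>\<Delta>\<rangle>\<close> need not extend a bunch
  \<open>U\<langle>T\<rangle>\<close> with \<open>T\<close> supporting \<open>\<Delta>\<close>. The coarser relation \<open>entails\<close> below, which
  compares resources by what is derivable from them, admits contraction; support of formulae is still
  monotone along it, and this gives the required decomposition of support along contexts.
\<close>

section \<open>Contexts and bunch-extension\<close>

text \<open>Derivability rules act inside one context. Composition turns nested fillings into a
  single filling, so that these rules apply underneath further surroundings.\<close>

primrec ctx_comp :: "'x bctx \<Rightarrow> 'x bctx \<Rightarrow> 'x bctx" where
  "ctx_comp Hole D = D"
| "ctx_comp (SemiL C \<Gamma>) D = SemiL (ctx_comp C D) \<Gamma>"
| "ctx_comp (SemiR \<Gamma> C) D = SemiR \<Gamma> (ctx_comp C D)"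
| "ctx_comp (CommaL C \<Gamma>) D = CommaL (ctx_comp C D) \<Gamma>"
| "ctx_comp (CommaR \<Gamma> C) D = CommaR \<Gamma> (ctx_comp C D)"

lemma fill_ctx_comp [simp]: "(ctx_comp C D)\<langle>\<Delta>\<rangle> = C\<langle>D\<langle>\<Delta>\<rangle>\<rangle>"
  by (induction C) auto

text \<open>An extension step always adds something. Coherence alone is recovered by adding the unit
  \<open>AUnit\<close> at the root, and reflexivity then follows from that of coherence.\<close>

lemma bext_coh:
  assumes "\<Gamma> \<cong> \<Delta>"
  shows "\<Gamma> \<succeq> \<Delta>"
proof -
  have "\<Gamma> \<cong> Hole\<langle>\<Delta> \<^bold>; \<emptyset>\<^sub>+\<rangle>"
    unfolding fill.simps by (rule coh.trans[OF assms coh.sym[OF coh.semi_unit]])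
  from bext.step[OF this] show ?thesis by simp
qed

lemma bext_refl: "\<Gamma> \<succeq> \<Gamma>"
  by (rule bext_coh[OF coh.refl])

lemma bext_fill: "\<Gamma> \<succeq> \<Delta> \<Longrightarrow> C\<langle>\<Gamma>\<rangle> \<succeq> C\<langle>\<Delta>\<rangle>"
proof (induction rule: bext.induct)
  case (step \<Gamma> D \<Delta> \<Delta>')
  show ?case
    using bext.step[of "C\<langle>\<Gamma>\<rangle>" "ctx_comp C D" \<Delta> \<Delta>'] coh.cong[OF step, of C] by simp
next
  case (trans \<Gamma> \<Delta> \<Sigma>)
  show ?case by (rule bext.trans[OF trans.IH])
qed

lemma bext_comma:
  assumes "\<Gamma> \<succeq> \<Gamma>'" "\<Delta> \<succeq> \<Delta>'"
  shows "(\<Gamma> \<^bold>, \<Delta>) \<succeq> (\<Gamma>' \<^bold>, \<Delta>')"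
  using bext.trans[OF bext_fill[OF assms(1), of "CommaL Hole \<Delta>", unfolded fill.simps]
      bext_fill[OF assms(2), of "CommaR \<Gamma>' Hole", unfolded fill.simps]] .

lemma bext_semiL: "(\<Gamma> \<^bold>; \<Delta>) \<succeq> \<Gamma>"
  using bext.step[of "\<Gamma> \<^bold>; \<Delta>" Hole \<Gamma> \<Delta>] coh.refl[of "\<Gamma> \<^bold>; \<Delta>"] by simp

lemma bext_semiR: "(\<Gamma> \<^bold>; \<Delta>) \<succeq> \<Delta>"
  by (rule bext.trans[OF bext_coh[OF coh.semi_comm] bext_semiL])


section \<open>Derivability and support of formulae\<close>

lemma deriv_mono: "deriv \<B> P p \<Longrightarrow> \<B> \<subseteq> \<X> \<Longrightarrow> deriv \<X> P p"
proof (induction rule: deriv.induct)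
  case (rule Ps P p)
  show ?case by (rule deriv.rule[of Ps]) (use rule in blast)+
next
  case (weak C Q p Q')
  show ?case by (rule deriv.weak[OF weak.IH[OF weak.prems]])
next
  case (contr C Q p)
  show ?case by (rule deriv.contr[OF contr.IH[OF contr.prems]])
next
  case (exch C Q p Q')
  show ?case by (rule deriv.exch[OF exch.IH[OF exch.prems] exch.hyps(2)])
next
  case (cut T q C p)
  show ?case by (rule deriv.cut[OF cut.IH(1)[OF cut.prems] cut.IH(2)[OF cut.prems]])
qed (rule deriv.taut)

text \<open>Quantifying over every base and every context makes this a preorder that is independent
  of the base and closed under contexts.\<close>

definition entails :: "'a bunch \<Rightarrow> 'a bunch \<Rightarrow> bool" where
  "entails S T \<longleftrightarrow> (\<forall>\<X> W p. deriv \<X> W\<langle>T\<rangle> p \<longrightarrow> deriv \<X> W\<langle>S\<rangle> p)"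

lemma entailsD: "entails S T \<Longrightarrow> deriv \<X> W\<langle>T\<rangle> p \<Longrightarrow> deriv \<X> W\<langle>S\<rangle> p"
  by (simp add: entails_def)

lemma entails_trans: "entails S T \<Longrightarrow> entails T V \<Longrightarrow> entails S V"
  by (simp add: entails_def)

lemma entails_fill: "entails S T \<Longrightarrow> entails C\<langle>S\<rangle> C\<langle>T\<rangle>"
  unfolding entails_def fill_ctx_comp[symmetric] by blast

lemma entails_bext: "S \<succeq> T \<Longrightarrow> entails S T"
proof (induction rule: bext.induct)
  case (step \<Gamma> C \<Delta> \<Delta>')
  show ?case
    unfolding entails_def
  proof (intro allI HOL.impI)
    fix \<X> W p
    assume "deriv \<X> W\<langle>C\<langle>\<Delta>\<rangle>\<rangle> p"
    then have "deriv \<X> W\<langle>C\<langle>\<Delta> \<^bold>; \<Delta>'\<rangle>\<rangle> p"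
      using deriv.weak[of \<X> "ctx_comp W C"] by simp
    then show "deriv \<X> W\<langle>\<Gamma>\<rangle> p"
      by (rule deriv.exch[OF _ coh.sym[OF step]])
  qed
qed (rule entails_trans)

lemma entails_contr: "entails S (S \<^bold>; S)"
  unfolding entails_def by (intro allI HOL.impI) (rule deriv.contr)

text \<open>Contraction first duplicates \<open>S\<close>; each copy is then replaced separately,
  using closure under contexts. The duplication is what \<open>\<succeq>\<close> cannot
  provide.\<close>

lemma entails_semi:
  assumes "entails S T" "entails S V"
  shows "entails S (T \<^bold>; V)"
proof -
  have "entails (S \<^bold>; S) (T \<^bold>; S)" "entails (T \<^bold>; S) (T \<^bold>; V)"
    using entails_fill[OF assms(1), of "SemiL Hole S"] entails_fill[OF assms(2), of "SemiR T Hole"]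
    by simp_all
  then show ?thesis
    using entails_contr entails_trans by blast
qed

text \<open>No induction is required: the clauses for atoms and \<open>Bot\<close> reduce to
  derivability, and all others quantify over larger bases.\<close>

lemma fsupp_base_mono: "fsupp \<B> S \<phi> \<Longrightarrow> \<B> \<subseteq> \<X> \<Longrightarrow> fsupp \<X> S \<phi>"
  by (cases \<phi>) (auto intro: deriv_mono dest: order_trans)

text \<open>Here \<open>A\<close> collects the resources that may stand in for \<open>S\<close>, and
  \<open>elim_atom\<close> is elimination for atomic goals. For \<open>Imp\<close> and
  \<open>Wand\<close> the resource of the antecedent is absorbed into the context and the induction
  hypothesis for the succedent applies, which is why \<open>U\<close> and the base are generalised.
  In every other case support is itself tested on atoms in contexts \<open>W\<close>, so
  \<open>elim_atom\<close> applies in the composite of \<open>W\<close> and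
  \<open>U\<close>.\<close>

lemma fsupp_elim:
  fixes A :: "'a base \<Rightarrow> 'a bunch \<Rightarrow> bool"
  assumes elim_atom: "\<And>\<X> U p. \<B> \<subseteq> \<X> \<Longrightarrow>
      (\<And>\<Y> V. \<X> \<subseteq> \<Y> \<Longrightarrow> A \<Y> V \<Longrightarrow> deriv \<Y> U\<langle>V\<rangle> p) \<Longrightarrow> deriv \<X> U\<langle>S\<rangle> p"
    and "\<B> \<subseteq> \<X>"
    and "\<And>\<Y> V. \<X> \<subseteq> \<Y> \<Longrightarrow> A \<Y> V \<Longrightarrow> fsupp \<Y> U\<langle>V\<rangle> \<chi>"
  shows "fsupp \<X> U\<langle>S\<rangle> \<chi>"
  using assms(2,3)
proof (induction \<chi> arbitrary: \<X> U)
  case (Atom p)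
  then show ?case using elim_atom by simp
next
  case Top
  show ?case
    unfolding fsupp.simps
  proof (intro allI HOL.impI)
    fix \<Z> W p
    assume *: "\<X> \<subseteq> \<Z>" "deriv \<Z> W\<langle>\<emptyset>\<^sub>+\<rangle> p"
    \<comment> \<open>The test in \<open>*\<close> persists to the larger base, where the support of
      the goal formula at \<open>U\<close> filled with \<open>V\<close> answers it. The remaining
      tested connectives follow the same pattern.\<close>
    have "deriv \<Y> W\<langle>U\<langle>V\<rangle>\<rangle> p" if "\<Z> \<subseteq> \<Y>" "A \<Y> V" for \<Y> V
    proof -
      have "fsupp \<Y> U\<langle>V\<rangle> \<^bold>\<top>" using Top.prems(2) * that by blast
      moreover have "deriv \<Y> W\<langle>\<emptyset>\<^sub>+\<rangle> p" using *(2) that(1) by (rule deriv_mono)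
      ultimately show ?thesis by simp
    qed
    then show "deriv \<Z> W\<langle>U\<langle>S\<rangle>\<rangle> p"
      using elim_atom[of \<Z> "ctx_comp W U" p] Top.prems(1) * by simp
  qed
next
  case Bot
  show ?case
    unfolding fsupp.simps
  proof (intro allI)
    fix W p
    \<comment> \<open>The clause for \<open>Bot\<close> stays within its base, so elimination takes
      place in \<open>\<X>\<close> itself.\<close>
    show "deriv \<X> W\<langle>U\<langle>S\<rangle>\<rangle> p"
      using elim_atom[of \<X> "ctx_comp W U" p] Bot by simp
  qed
next
  case MTop
  show ?case
    unfolding fsupp.simps
  proof (intro allI HOL.impI)
    fix \<Z> W p
    assume *: "\<X> \<subseteq> \<Z>" "deriv \<Z> W\<langle>\<emptyset>\<^sub>\<times>\<rangle> p"
    have "deriv \<Y> W\<langle>U\<langle>V\<rangle>\<rangle> p" if "\<Z> \<subseteq> \<Y>" "A \<Y> V" for \<Y> V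
    proof -
      have "fsupp \<Y> U\<langle>V\<rangle> \<^bold>\<top>\<^sup>*" using MTop.prems(2) * that by blast
      moreover have "deriv \<Y> W\<langle>\<emptyset>\<^sub>\<times>\<rangle> p" using *(2) that(1) by (rule deriv_mono)
      ultimately show ?thesis by simp
    qed
    then show "deriv \<Z> W\<langle>U\<langle>S\<rangle>\<rangle> p"
      using elim_atom[of \<Z> "ctx_comp W U" p] MTop.prems(1) * by simp
  qed
next
  case (And \<phi> \<psi>)
  show ?case
    unfolding fsupp.simps(1,2)
  proof (intro allI HOL.impI)
    fix \<Z> W p
    assume *: "\<X> \<subseteq> \<Z>" "ssupp \<Z> W (Elem \<phi> \<^bold>; Elem \<psi>) (Atom p)"
    have "deriv \<Y> W\<langle>U\<langle>V\<rangle>\<rangle> p" if "\<Z> \<subseteq> \<Y>" "A \<Y> V" for \<Y> V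
    proof -
      have "fsupp \<Y> U\<langle>V\<rangle> (\<phi> \<^bold>\<and> \<psi>)" using And.prems(2) * that by blast
      moreover have "ssupp \<Y> W (Elem \<phi> \<^bold>; Elem \<psi>) (Atom p)" using * that by auto
      ultimately show ?thesis unfolding fsupp.simps(1,2) by blast
    qed
    then show "deriv \<Z> W\<langle>U\<langle>S\<rangle>\<rangle> p"
      using elim_atom[of \<Z> "ctx_comp W U" p] And.prems(1) * by simp
  qed
next
  case (Or \<phi> \<psi>)
  show ?case
    unfolding fsupp.simps(1,4)
  proof (intro allI HOL.impI)
    fix \<Z> W p
    assume *: "\<X> \<subseteq> \<Z>" "ssupp \<Z> W (Elem \<phi>) (Atom p)" "ssupp \<Z> W (Elem \<psi>) (Atom p)"
    have "deriv \<Y> W\<langle>U\<langle>V\<rangle>\<rangle> p" if "\<Z> \<subseteq> \<Y>" "A \<Y> V" for \<Y> V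
    proof -
      have "fsupp \<Y> U\<langle>V\<rangle> (\<phi> \<^bold>\<or> \<psi>)" using Or.prems(2) * that by blast
      moreover have "ssupp \<Y> W (Elem \<phi>) (Atom p)" "ssupp \<Y> W (Elem \<psi>) (Atom p)"
        using * that by auto
      ultimately show ?thesis unfolding fsupp.simps(1,4) by blast
    qed
    then show "deriv \<Z> W\<langle>U\<langle>S\<rangle>\<rangle> p"
      using elim_atom[of \<Z> "ctx_comp W U" p] Or.prems(1) * by simp
  qed
next
  case (Imp \<phi> \<psi>)
  \<comment> \<open>The resource \<open>V\<close> of the antecedent becomes part of the context
    around \<open>S\<close>, leaving the smaller goal \<open>\<psi>\<close>.\<close>
  have "fsupp \<Y> (SemiL U V)\<langle>S\<rangle> \<psi>" if "\<X> \<subseteq> \<Y>" "fsupp \<Y> V \<phi>" for \<Y> V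
  proof (rule Imp.IH(2))
    show "\<B> \<subseteq> \<Y>" using that Imp.prems(1) by blast
  next
    fix \<Z> V'
    assume *: "\<Y> \<subseteq> \<Z>" "A \<Z> V'"
    then have "fsupp \<Z> U\<langle>V'\<rangle> (\<phi> \<^bold>\<rightarrow> \<psi>)" using Imp.prems(2) that by blast
    then show "fsupp \<Z> (SemiL U V)\<langle>V'\<rangle> \<psi>" using fsupp_base_mono[OF that(2) *(1)] by simp
  qed
  then show ?case by simp
next
  case (Star \<phi> \<psi>)
  show ?case
    unfolding fsupp.simps(1,3)
  proof (intro allI HOL.impI)
    fix \<Z> W p
    assume *: "\<X> \<subseteq> \<Z>" "ssupp \<Z> W (Elem \<phi> \<^bold>, Elem \<psi>) (Atom p)"
    have "deriv \<Y> W\<langle>U\<langle>V\<rangle>\<rangle> p" if "\<Z> \<subseteq> \<Y>" "A \<Y> V" for \<Y> V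
    proof -
      have "fsupp \<Y> U\<langle>V\<rangle> (\<phi> \<^bold>* \<psi>)" using Star.prems(2) * that by blast
      moreover have "ssupp \<Y> W (Elem \<phi> \<^bold>, Elem \<psi>) (Atom p)" using * that by auto
      ultimately show ?thesis unfolding fsupp.simps(1,3) by blast
    qed
    then show "deriv \<Z> W\<langle>U\<langle>S\<rangle>\<rangle> p"
      using elim_atom[of \<Z> "ctx_comp W U" p] Star.prems(1) * by simp
  qed
next
  case (Wand \<phi> \<psi>)
  have "fsupp \<Y> (CommaL U V)\<langle>S\<rangle> \<psi>" if "\<X> \<subseteq> \<Y>" "fsupp \<Y> V \<phi>" for \<Y> V
  proof (rule Wand.IH(2))
    show "\<B> \<subseteq> \<Y>" using that Wand.prems(1) by blast
  next
    fix \<Z> V'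
    assume *: "\<Y> \<subseteq> \<Z>" "A \<Z> V'"
    then have "fsupp \<Z> U\<langle>V'\<rangle> (\<phi> \<^bold>-\<^bold>* \<psi>)" using Wand.prems(2) that by blast
    then show "fsupp \<Z> (CommaL U V)\<langle>V'\<rangle> \<psi>" using fsupp_base_mono[OF that(2) *(1)] by simp
  qed
  then show ?case by simp
qed

text \<open>This is elimination for the family whose only resource is \<open>T\<close>: the
  assumption \<open>entails S T\<close> supplies its atomic case.\<close>

lemma fsupp_entails:
  assumes "entails S T" "fsupp \<B> T \<phi>"
  shows "fsupp \<B> S \<phi>"
proof -
  have "fsupp \<B> Hole\<langle>S\<rangle> \<phi>"
    by (rule fsupp_elim[where A = "\<lambda>_ V. V = T" and \<B> = \<B>])
      (use assms in \<open>auto intro: entailsD fsupp_base_mono\<close>)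
  then show ?thesis by simp
qed


section \<open>Support of bunches\<close>

lemma bsupp_base_mono: "bsupp \<B> S \<Gamma> \<Longrightarrow> \<B> \<subseteq> \<X> \<Longrightarrow> bsupp \<X> S \<Gamma>"
proof (induction \<Gamma> arbitrary: S)
  case (Elem \<phi>)
  then show ?case by (simp add: fsupp_base_mono)
qed (simp_all, blast+)

text \<open>Formulae are handled through \<open>entails\<close>; each structural clause refers to
  its resource at most through \<open>\<succeq>\<close>, so transitivity suffices.\<close>

lemma bsupp_bext: "bsupp \<B> T \<Gamma> \<Longrightarrow> S \<succeq> T \<Longrightarrow> bsupp \<B> S \<Gamma>"
  by (cases \<Gamma>) (auto intro: fsupp_entails entails_bext, (blast intro: bext.trans)+)

lemma bsupp_fill_mono:
  assumes "\<And>S. bsupp \<B> S \<Delta> \<Longrightarrow> bsupp \<B> S \<Delta>'" "bsupp \<B> S C\<langle>\<Delta>\<rangle>"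
  shows "bsupp \<B> S C\<langle>\<Delta>'\<rangle>"
  using assms(2)
proof (induction C arbitrary: S)
  case Hole
  then show ?case by (simp add: assms(1))
qed (simp_all, blast+)

text \<open>Monotonicity lifts both witnesses to \<open>S\<close>, and conversely \<open>S\<close>
  serves as both. Additive structure thus becomes plain conjunction.\<close>

lemma bsupp_semi_iff: "bsupp \<B> S (\<Gamma> \<^bold>; \<Delta>) \<longleftrightarrow> bsupp \<B> S \<Gamma> \<and> bsupp \<B> S \<Delta>"
  using bsupp_bext bext_refl by (auto; blast)

text \<open>The additive equations are laws of conjunction. Each multiplicative equation is matched
  by the same rearrangement of the witnessing resources.\<close>

lemma bsupp_coh: "\<Gamma> \<cong> \<Delta> \<Longrightarrow> bsupp \<B> S \<Gamma> \<longleftrightarrow> bsupp \<B> S \<Delta>"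
proof (induction arbitrary: S rule: coh.induct)
  case (comma_comm \<Gamma> \<Delta>)
  have "S \<succeq> (P \<^bold>, Q) \<longleftrightarrow> S \<succeq> (Q \<^bold>, P)" for P Q :: "'a bunch"
    using bext.trans bext_coh coh.comma_comm by blast
  then show ?case by auto
next
  case (comma_assoc \<Gamma> \<Delta> \<Sigma>)
  show ?case
  proof
    assume "bsupp \<B> S ((\<Gamma> \<^bold>, \<Delta>) \<^bold>, \<Sigma>)"
    then obtain Q Q3 Q1 Q2 where *: "S \<succeq> (Q \<^bold>, Q3)" "Q \<succeq> (Q1 \<^bold>, Q2)"
      "bsupp \<B> Q1 \<Gamma>" "bsupp \<B> Q2 \<Delta>" "bsupp \<B> Q3 \<Sigma>" by auto
    have "S \<succeq> (Q1 \<^bold>, (Q2 \<^bold>, Q3))"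
      using * bext_comma[OF *(2) bext_refl] bext_coh[OF coh.comma_assoc] bext.trans by metis
    then show "bsupp \<B> S (\<Gamma> \<^bold>, (\<Delta> \<^bold>, \<Sigma>))" using * bext_refl by (auto; blast)
  next
    assume "bsupp \<B> S (\<Gamma> \<^bold>, (\<Delta> \<^bold>, \<Sigma>))"
    then obtain Q1 Q Q2 Q3 where *: "S \<succeq> (Q1 \<^bold>, Q)" "Q \<succeq> (Q2 \<^bold>, Q3)"
      "bsupp \<B> Q1 \<Gamma>" "bsupp \<B> Q2 \<Delta>" "bsupp \<B> Q3 \<Sigma>" by auto
    have "S \<succeq> ((Q1 \<^bold>, Q2) \<^bold>, Q3)"
      using * bext_comma[OF bext_refl *(2)] bext_coh[OF coh.sym[OF coh.comma_assoc]] bext.trans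
      by metis
    then show "bsupp \<B> S ((\<Gamma> \<^bold>, \<Delta>) \<^bold>, \<Sigma>)" using * bext_refl by (auto; blast)
  qed
next
  case (comma_unit \<Gamma>)
  show ?case
  proof
    assume "bsupp \<B> S (\<Gamma> \<^bold>, \<emptyset>\<^sub>\<times>)"
    then obtain Q1 Q2 where *: "S \<succeq> (Q1 \<^bold>, Q2)" "bsupp \<B> Q1 \<Gamma>" "Q2 \<succeq> \<emptyset>\<^sub>\<times>" by auto
    have "S \<succeq> Q1"
      using * bext_comma[OF bext_refl *(3)] bext_coh[OF coh.comma_unit] bext.trans by metis
    then show "bsupp \<B> S \<Gamma>" using * bsupp_bext by blast
  next
    assume "bsupp \<B> S \<Gamma>"
    moreover have "S \<succeq> (S \<^bold>, \<emptyset>\<^sub>\<times>)" by (rule bext_coh[OF coh.sym[OF coh.comma_unit]])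
    ultimately show "bsupp \<B> S (\<Gamma> \<^bold>, \<emptyset>\<^sub>\<times>)" using bext_refl by auto
  qed
next
  case (cong \<Delta> \<Delta>' C)
  then show ?case using bsupp_fill_mono by metis
qed (auto simp: bsupp_semi_iff simp del: bsupp.simps(5))

text \<open>The context \<open>U\<close> of atoms records how the surroundings of the hole are
  supported. The last property makes it reusable: in any larger base, any supported bunch may be put
  in place of \<open>\<Delta>\<close>, as an elimination rule demands.\<close>

lemma bsupp_fillE:
  assumes "bsupp \<B> S C\<langle>\<Delta>\<rangle>"
  obtains U T where "entails S U\<langle>T\<rangle>" "bsupp \<B> T \<Delta>"
    "\<And>\<X> V \<Sigma>. \<B> \<subseteq> \<X> \<Longrightarrow> bsupp \<X> V \<Sigma> \<Longrightarrow> bsupp \<X> U\<langle>V\<rangle> C\<langle>\<Sigma>\<rangle>"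
proof -
  have "\<exists>U T. entails S U\<langle>T\<rangle> \<and> bsupp \<B> T \<Delta> \<and>
      (\<forall>\<X> V \<Sigma>. \<B> \<subseteq> \<X> \<longrightarrow> bsupp \<X> V \<Sigma> \<longrightarrow> bsupp \<X> U\<langle>V\<rangle> C\<langle>\<Sigma>\<rangle>)"
    using assms
  proof (induction C arbitrary: S)
    case Hole
    then show ?case
      using entails_bext[OF bext_refl] by (intro exI[of _ Hole] exI[of _ S]) simp
  next
    case (SemiL C \<Gamma>)
    from SemiL.prems have S: "bsupp \<B> S C\<langle>\<Delta>\<rangle>" "bsupp \<B> S \<Gamma>"
      unfolding fill.simps bsupp_semi_iff by auto
    from SemiL.IH[OF S(1)] obtain U T where "entails S U\<langle>T\<rangle>" "bsupp \<B> T \<Delta>"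
      and U: "\<forall>\<X> V \<Sigma>. \<B> \<subseteq> \<X> \<longrightarrow> bsupp \<X> V \<Sigma> \<longrightarrow> bsupp \<X> U\<langle>V\<rangle> C\<langle>\<Sigma>\<rangle>" by blast
    \<comment> \<open>At an additive node all of \<open>S\<close> is kept as the sibling supporting
      \<open>\<Gamma>\<close>, while \<open>S\<close> is also decomposed for the branch with the
      hole; \<open>entails_semi\<close> permits this double use.\<close>
    moreover have "bsupp \<X> (SemiL U S)\<langle>V\<rangle> (SemiL C \<Gamma>)\<langle>\<Sigma>\<rangle>"
      if "\<B> \<subseteq> \<X>" "bsupp \<X> V \<Sigma>" for \<X> V \<Sigma>
    proof -
      have "bsupp \<X> U\<langle>V\<rangle> C\<langle>\<Sigma>\<rangle>" using U that by blast
      moreover have "bsupp \<X> S \<Gamma>" using S(2) that(1) by (rule bsupp_base_mono)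
      ultimately show ?thesis
        unfolding fill.simps bsupp_semi_iff
        by (auto intro: bsupp_bext[OF _ bext_semiL] bsupp_bext[OF _ bext_semiR])
    qed
    moreover have "entails S (SemiL U S)\<langle>T\<rangle>"
      unfolding fill.simps by (intro entails_semi entails_bext[OF bext_refl]) fact
    ultimately show ?case using \<open>bsupp \<B> T \<Delta>\<close> by blast
  next
    case (SemiR \<Gamma> C)
    from SemiR.prems have S: "bsupp \<B> S C\<langle>\<Delta>\<rangle>" "bsupp \<B> S \<Gamma>"
      unfolding fill.simps bsupp_semi_iff by auto
    from SemiR.IH[OF S(1)] obtain U T where "entails S U\<langle>T\<rangle>" "bsupp \<B> T \<Delta>"
      and U: "\<forall>\<X> V \<Sigma>. \<B> \<subseteq> \<X> \<longrightarrow> bsupp \<X> V \<Sigma> \<longrightarrow> bsupp \<X> U\<langle>V\<rangle> C\<langle>\<Sigma>\<rangle>" by blast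
    moreover have "bsupp \<X> (SemiR S U)\<langle>V\<rangle> (SemiR \<Gamma> C)\<langle>\<Sigma>\<rangle>"
      if "\<B> \<subseteq> \<X>" "bsupp \<X> V \<Sigma>" for \<X> V \<Sigma>
    proof -
      have "bsupp \<X> U\<langle>V\<rangle> C\<langle>\<Sigma>\<rangle>" using U that by blast
      moreover have "bsupp \<X> S \<Gamma>" using S(2) that(1) by (rule bsupp_base_mono)
      ultimately show ?thesis
        unfolding fill.simps bsupp_semi_iff
        by (auto intro: bsupp_bext[OF _ bext_semiL] bsupp_bext[OF _ bext_semiR])
    qed
    moreover have "entails S (SemiR S U)\<langle>T\<rangle>"
      unfolding fill.simps by (intro entails_semi entails_bext[OF bext_refl]) fact
    ultimately show ?case using \<open>bsupp \<B> T \<Delta>\<close> by blast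
  next
    case (CommaL C \<Gamma>)
    from CommaL.prems obtain P Q where S: "S \<succeq> (P \<^bold>, Q)" "bsupp \<B> P C\<langle>\<Delta>\<rangle>" "bsupp \<B> Q \<Gamma>"
      by auto
    from CommaL.IH[OF S(2)] obtain U T where T: "entails P U\<langle>T\<rangle>" "bsupp \<B> T \<Delta>"
      and U: "\<forall>\<X> V \<Sigma>. \<B> \<subseteq> \<X> \<longrightarrow> bsupp \<X> V \<Sigma> \<longrightarrow> bsupp \<X> U\<langle>V\<rangle> C\<langle>\<Sigma>\<rangle>" by blast
    \<comment> \<open>At a multiplicative node the support clause has already split
      \<open>S\<close>: \<open>P\<close> is decomposed further and \<open>Q\<close> stays as the
      sibling.\<close>
    have "entails S (CommaL U Q)\<langle>T\<rangle>"
      using entails_trans[OF entails_bext[OF S(1)]] entails_fill[OF T(1), of "CommaL Hole Q"]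
      by simp
    moreover have "bsupp \<X> (CommaL U Q)\<langle>V\<rangle> (CommaL C \<Gamma>)\<langle>\<Sigma>\<rangle>"
      if "\<B> \<subseteq> \<X>" "bsupp \<X> V \<Sigma>" for \<X> V \<Sigma>
    proof -
      have "bsupp \<X> U\<langle>V\<rangle> C\<langle>\<Sigma>\<rangle>" using U that by blast
      moreover have "bsupp \<X> Q \<Gamma>" using S(3) that(1) by (rule bsupp_base_mono)
      ultimately show ?thesis
        unfolding fill.simps bsupp.simps using bext_refl by blast
    qed
    ultimately show ?case using T(2) by blast
  next
    case (CommaR \<Gamma> C)
    from CommaR.prems obtain P Q where S: "S \<succeq> (Q \<^bold>, P)" "bsupp \<B> P C\<langle>\<Delta>\<rangle>" "bsupp \<B> Q \<Gamma>"
      by auto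
    from CommaR.IH[OF S(2)] obtain U T where T: "entails P U\<langle>T\<rangle>" "bsupp \<B> T \<Delta>"
      and U: "\<forall>\<X> V \<Sigma>. \<B> \<subseteq> \<X> \<longrightarrow> bsupp \<X> V \<Sigma> \<longrightarrow> bsupp \<X> U\<langle>V\<rangle> C\<langle>\<Sigma>\<rangle>" by blast
    have "entails S (CommaR Q U)\<langle>T\<rangle>"
      using entails_trans[OF entails_bext[OF S(1)]] entails_fill[OF T(1), of "CommaR Q Hole"]
      by simp
    moreover have "bsupp \<X> (CommaR Q U)\<langle>V\<rangle> (CommaR \<Gamma> C)\<langle>\<Sigma>\<rangle>"
      if "\<B> \<subseteq> \<X>" "bsupp \<X> V \<Sigma>" for \<X> V \<Sigma>
    proof -
      have "bsupp \<X> U\<langle>V\<rangle> C\<langle>\<Sigma>\<rangle>" using U that by blast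
      moreover have "bsupp \<X> Q \<Gamma>" using S(3) that(1) by (rule bsupp_base_mono)
      ultimately show ?thesis
        unfolding fill.simps bsupp.simps using bext_refl by blast
    qed
    ultimately show ?case using T(2) by blast
  qed
  then show thesis by (elim exE conjE) (rule that; blast)
qed


section \<open>Soundness\<close>

lemma valid_iff: "\<Gamma> \<tturnstile> \<phi> \<longleftrightarrow> (\<forall>\<B> S. bsupp \<B> S \<Gamma> \<longrightarrow> fsupp \<B> S \<phi>)"
  by (auto simp: valid_def)

text \<open>Common form of the elimination rules. \<open>F\<close> lists the bunches that replace
  the eliminated \<open>\<theta>\<close>: two for disjunction, none for \<open>Bot\<close>, one
  otherwise. The premise \<open>elim\<close> is the support clause of \<open>\<theta>\<close>, read
  as a test against \<open>F\<close> with atomic goals.\<close>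

lemma valid_elim:
  fixes \<Delta> :: "'a formula bunch"
  assumes "\<Delta> \<tturnstile> \<theta>"
    and elim: "\<And>\<B> \<X> S U p. fsupp \<B> S \<theta> \<Longrightarrow> \<B> \<subseteq> \<X> \<Longrightarrow>
      (\<And>\<Sigma>. \<Sigma> \<in> F \<Longrightarrow> ssupp \<X> U \<Sigma> (Atom p)) \<Longrightarrow> deriv \<X> U\<langle>S\<rangle> p"
    and "\<And>\<Sigma>. \<Sigma> \<in> F \<Longrightarrow> C\<langle>\<Sigma>\<rangle> \<tturnstile> \<chi>"
  shows "C\<langle>\<Delta>\<rangle> \<tturnstile> \<chi>"
  unfolding valid_iff
proof (intro allI HOL.impI)
  fix \<B> :: "'a base" and S
  assume "bsupp \<B> S C\<langle>\<Delta>\<rangle>"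
  then obtain U T where U: "entails S U\<langle>T\<rangle>" "bsupp \<B> T \<Delta>"
    "\<And>\<X> V \<Sigma>. \<B> \<subseteq> \<X> \<Longrightarrow> bsupp \<X> V \<Sigma> \<Longrightarrow> bsupp \<X> U\<langle>V\<rangle> C\<langle>\<Sigma>\<rangle>"
    by (rule bsupp_fillE) blast
  have T: "fsupp \<B> T \<theta>" using assms(1) U(2) by (simp add: valid_iff)
  have "fsupp \<B> U\<langle>T\<rangle> \<chi>"
  \<comment> \<open>The admissible substitutes for \<open>T\<close> are the resources supporting
    some bunch of \<open>F\<close>; the premises for \<open>F\<close> yield \<open>\<chi>\<close> at
    each of them.\<close>
  proof (rule fsupp_elim[where A = "\<lambda>\<Y> V. \<exists>\<Sigma>\<in>F. bsupp \<Y> V \<Sigma>" and \<B> = \<B>])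
    fix \<X> W p
    assume "\<B> \<subseteq> \<X>"
      and "\<And>\<Y> V. \<X> \<subseteq> \<Y> \<Longrightarrow> \<exists>\<Sigma>\<in>F. bsupp \<Y> V \<Sigma> \<Longrightarrow> deriv \<Y> W\<langle>V\<rangle> p"
    then show "deriv \<X> W\<langle>T\<rangle> p" by (intro elim[OF T]) auto
  next
    fix \<Y> V
    assume "\<B> \<subseteq> \<Y>" "\<exists>\<Sigma>\<in>F. bsupp \<Y> V \<Sigma>"
    then show "fsupp \<Y> U\<langle>V\<rangle> \<chi>" using assms(3) U(3) unfolding valid_iff by blast
  qed simp
  then show "fsupp \<B> S \<chi>" by (rule fsupp_entails[OF U(1)])
qed

theorem theorem5p1:
  fixes \<Gamma> :: "'a::{countable, infinite} formula bunch" and \<phi> :: "'a formula"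
  assumes "\<Gamma> \<turnstile> \<phi>"
  shows "\<Gamma> \<tturnstile> \<phi>"
  using assms
proof (induction rule: nbi.induct)
  case (ax \<phi>)
  show ?case by (simp add: valid_iff)
next
  case (exch \<Gamma>' \<phi> \<Gamma>)
  then show ?case using bsupp_coh unfolding valid_iff by blast
next
  case (weak C \<Delta> \<phi> \<Delta>')
  \<comment> \<open>Weakening and contraction are projection and duplication of a conjunction,
    carried through the context.\<close>
  then show ?case using bsupp_fill_mono bsupp_semi_iff unfolding valid_iff by metis
next
  case (contr C \<Delta> \<phi>)
  then show ?case using bsupp_fill_mono bsupp_semi_iff unfolding valid_iff by metis
next
  case mtopI
  show ?case by (auto simp: valid_iff intro: entailsD[OF entails_bext])
next
  case (mtopE C \<chi> \<Delta>)
  show ?case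
    \<comment> \<open>As a resource, \<open>MUnit\<close> supports itself, so the test against
      \<open>F\<close> includes the derivability test in the clause for \<open>MTop\<close>.\<close>
    by (rule valid_elim[OF mtopE.IH(2), where F = "{\<emptyset>\<^sub>\<times>}"])
      (use mtopE.IH(1) bext_refl[of "\<emptyset>\<^sub>\<times>"] in \<open>auto, blast\<close>)
next
  case (wandI \<Gamma> \<phi> \<psi>)
  then show ?case
    using bsupp_base_mono bext_refl by (simp add: valid_iff) blast
next
  case (wandE \<Gamma> \<phi> \<psi> \<Delta>)
  show ?case
    unfolding valid_iff
  proof (intro allI HOL.impI)
    fix \<B> :: "'a base" and S
    assume "bsupp \<B> S (\<Gamma> \<^bold>, \<Delta>)"
    then obtain Q1 Q2 where S: "S \<succeq> (Q1 \<^bold>, Q2)" "bsupp \<B> Q1 \<Gamma>" "bsupp \<B> Q2 \<Delta>" by auto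
    \<comment> \<open>\<open>Q1\<close> supports the wand, whose clause is instantiated at the
      resource \<open>Q2\<close>.\<close>
    then have "fsupp \<B> (Q1 \<^bold>, Q2) \<psi>" using wandE.IH by (auto simp: valid_iff)
    then show "fsupp \<B> S \<psi>" by (rule fsupp_entails[OF entails_bext[OF S(1)]])
  qed
next
  case (starI \<Gamma> \<phi> \<Delta> \<psi>)
  show ?case
    unfolding valid_iff
  proof (intro allI HOL.impI)
    fix \<B> :: "'a base" and S
    assume "bsupp \<B> S (\<Gamma> \<^bold>, \<Delta>)"
    then have "bsupp \<B> S (Elem \<phi> \<^bold>, Elem \<psi>)"
      using starI.IH unfolding valid_iff bsupp.simps by metis
    \<comment> \<open>Support of the pair persists to larger bases, so the atomic test in the clause
      for \<open>Star\<close> can be applied at \<open>S\<close> itself.\<close>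
    then show "fsupp \<B> S (\<phi> \<^bold>* \<psi>)"
      using bsupp_base_mono unfolding fsupp.simps(3) ssupp.simps by blast
  qed
next
  case (starE C \<phi> \<psi> \<chi> \<Delta>)
  show ?case
    by (rule valid_elim[OF starE.IH(2), where F = "{Elem \<phi> \<^bold>, Elem \<psi>}"])
      (use starE.IH(1) in \<open>auto simp del: ssupp.simps\<close>)
next
  case topI
  \<comment> \<open>Support of \<open>AUnit\<close> carries no information about \<open>S\<close>,
    so the extension has to be found for every resource: \<open>S\<close> is coherent with
    \<open>S\<close> joined additively to the unit.\<close>
  have "S \<succeq> \<emptyset>\<^sub>+" for S :: "'a bunch"
    using bext.trans[OF bext_coh[OF coh.sym[OF coh.semi_unit]] bext_semiR] .
  then show ?case by (auto simp: valid_iff intro: entailsD[OF entails_bext])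
next
  case (topE C \<chi> \<Delta>)
  show ?case
    by (rule valid_elim[OF topE.IH(2), where F = "{\<emptyset>\<^sub>+}"]) (use topE.IH(1) in auto)
next
  case (impI \<Gamma> \<phi> \<psi>)
  show ?case
    unfolding valid_iff
  proof (intro allI HOL.impI)
    fix \<B> :: "'a base" and S
    assume "bsupp \<B> S \<Gamma>"
    then have "bsupp \<X> (S \<^bold>; U) (\<Gamma> \<^bold>; Elem \<phi>)"
      if "\<B> \<subseteq> \<X>" "bsupp \<X> U (Elem \<phi>)" for \<X> U
      unfolding bsupp_semi_iff using that
      by (auto intro: bsupp_bext[OF _ bext_semiL] bsupp_bext[OF _ bext_semiR] bsupp_base_mono
          simp del: bsupp.simps)
    then show "fsupp \<B> S (\<phi> \<^bold>\<rightarrow> \<psi>)" using impI.IH by (simp add: valid_iff del: bsupp.simps(5))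
  qed
next
  case (impE \<Gamma> \<phi> \<psi> \<Delta>)
  show ?case
    unfolding valid_iff
  proof (intro allI HOL.impI)
    fix \<B> :: "'a base" and S
    assume "bsupp \<B> S (\<Gamma> \<^bold>; \<Delta>)"
    \<comment> \<open>Both premises hold at the same \<open>S\<close>, so the implication uses
      \<open>S\<close> twice; contraction then merges the copies.\<close>
    then have "fsupp \<B> (S \<^bold>; S) \<psi>"
      using impE.IH unfolding bsupp_semi_iff by (auto simp: valid_iff)
    then show "fsupp \<B> S \<psi>" by (rule fsupp_entails[OF entails_contr])
  qed
next
  case (andI \<Gamma> \<phi> \<Delta> \<psi>)
  show ?case
    unfolding valid_iff
  proof (intro allI HOL.impI)
    fix \<B> :: "'a base" and S
    assume "bsupp \<B> S (\<Gamma> \<^bold>; \<Delta>)"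
    then have "bsupp \<B> S (Elem \<phi> \<^bold>; Elem \<psi>)"
      using andI.IH unfolding valid_iff bsupp_semi_iff bsupp.simps by blast
    then show "fsupp \<B> S (\<phi> \<^bold>\<and> \<psi>)"
      using bsupp_base_mono unfolding fsupp.simps(2) ssupp.simps by blast
  qed
next
  case (andE C \<phi> \<psi> \<chi> \<Delta>)
  show ?case
    by (rule valid_elim[OF andE.IH(2), where F = "{Elem \<phi> \<^bold>; Elem \<psi>}"])
      (use andE.IH(1) in \<open>auto simp del: ssupp.simps\<close>)
next
  case (orI1 \<Gamma> \<phi> \<psi>)
  then show ?case
    unfolding valid_iff fsupp.simps ssupp.simps bsupp.simps by (meson fsupp_base_mono order_refl)
next
  case (orI2 \<Gamma> \<psi> \<phi>)
  then show ?case
    unfolding valid_iff fsupp.simps ssupp.simps bsupp.simps by (meson fsupp_base_mono order_refl)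
next
  case (orE C \<phi> \<chi> \<psi> \<Delta>)
  show ?case
    by (rule valid_elim[OF orE.IH(3), where F = "{Elem \<phi>, Elem \<psi>}"])
      (use orE.IH(1,2) in \<open>auto simp del: ssupp.simps\<close>)
next
  case (botE \<Gamma> \<phi>)
  \<comment> \<open>With the trivial context and no cases to consider, elimination is ex falso;
    derivability obtained from \<open>Bot\<close> is carried to the larger base by
    \<open>deriv_mono\<close>.\<close>
  have "Hole\<langle>\<Gamma>\<rangle> \<tturnstile> \<phi>"
    by (rule valid_elim[OF botE.IH, where F = "{}"]) (auto intro: deriv_mono)
  then show ?case by simp
qed

end
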